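(* There exists an infinitely renormalizable $C^{1+Lip}$ symmetric bimodal map $g$ such that $$R g=g.$$
   Context: **Class of maps.** $C^{1+Lip}$ means $C^1$ with Lipschitz derivative. A $C^{1+Lip}$ symmetric bimodal map is a $C^{1+Lip}$ map $b:[0,1]\to[0,1]$ with $b(1-x)=1-b(x)$ and critical points $c_l<c_r=1-c_l$, strictly decreasing on $[0,c_l]$, strictly increasing on $[c_l,c_r]$, strictly decreasing on $[c_r,1]$, with $b(c_l)=0$, $b(c_r)=1$. Put $q=b(0)$, $I_L=[0,q]$, $I_R=[1-q,1]$; it is assumed that $c_l<q<\frac12$ and $b(I_L)\subset I_L$ (hence $b(I_R)\subset I_R$), so $b|_{I_L}$ and $b|_{I_R}$ are unimodal. **Renormalization (period tripling type).** $b$ is renormalizable if, with $I_l=[b^5(0),b^2(0)]$ and $I_r=1-I_l=[b^2(1),b^5(1)]$ (where $b^k$ is the $k$-th iterate, and $b^5(0)<b^2(0)$), one has $c_l\in I_l$, $c_r\in I_r$; $I_l,b(I_l),b^2(I_l)$ are pairwise disjoint and $I_r,b(I_r),b^2(I_r)$ are pairwise disjoint; $b^3(I_l)\subset I_l$ and $b^3(I_r)\subset I_r$. Let $h_l:I_L\to I_l$ and $h_r:I_R\to I_r$ be the orientation-reversing affine bijections. The renormalization $Rb$ is the symmetric bimodal map equal to $h_l^{-1}\circ b^3\circ h_l$ on $I_L$ and to $h_r^{-1}\circ b^3\circ h_r$ on $I_R$, these two unimodal pieces being joined over the gap $[q,1-q]$ by an increasing $C^{1+Lip}$ curve. Since the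 joining curve is a free choice, $Rb$ is regarded as determined by its restriction to $I_L\cup I_R$; the equation $Rg=g$ means equality on $I_L\cup I_R$ (with the joining curve of $Rg$ then taken to be that of $g$). $b$ is infinitely renormalizable if $b,Rb,R^2b,\dots$ are all renormalizable and the corresponding nested intervals around $c_l$ and around $c_r$ (the images, under the composed affine rescalings, of the successive $I_l$, $I_r$) have lengths tending to $0$. *)

theory Defs
  imports "HOL-Analysis.Analysis"
begin

text \<open>
  Self-maps of the unit interval are represented by total functions on the reals; only their
  values on \<open>{0..1}\<close> matter.
\<close>

definition C1_Lip_on :: "real set \<Rightarrow> (real \<Rightarrow> real) \<Rightarrow> bool" where
  "C1_Lip_on S f \<longleftrightarrow>
     (\<exists>D C. (\<forall>x\<in>S. (f has_real_derivative D x) (at x within S)) \<and> C-lipschitz_on S D)"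

text \<open>\<open>I\<^sub>L = [0,q]\<close> and \<open>I\<^sub>R = [1-q,1]\<close>, where \<open>q = b(0)\<close>.\<close>

definition I_L :: "(real \<Rightarrow> real) \<Rightarrow> real set" where
  "I_L b = {0..b 0}"

definition I_R :: "(real \<Rightarrow> real) \<Rightarrow> real set" where
  "I_R b = {1 - b 0..1}"

text \<open>
  \<open>c\<close> is the left critical point \<open>c\<^sub>l\<close>; the right one is \<open>c\<^sub>r = 1 - c\<close>. These are required to be
  the only zeros of the derivative in \<open>[0,1]\<close> (one-sided at the end points).
\<close>

definition sym_bimodal_at :: "(real \<Rightarrow> real) \<Rightarrow> real \<Rightarrow> bool" where
  "sym_bimodal_at b c \<longleftrightarrow>
     b ` {0..1} \<subseteq> {0..1} \<and>
     C1_Lip_on {0..1} b \<and>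
     (\<forall>x\<in>{0..1}. b (1 - x) = 1 - b x) \<and>
     0 \<le> c \<and> c < 1 - c \<and>
     (\<forall>x\<in>{0..1}. (b has_real_derivative 0) (at x within {0..1}) \<longleftrightarrow> x = c \<or> x = 1 - c) \<and>
     strict_antimono_on {0..c} b \<and>
     strict_mono_on {c..1 - c} b \<and>
     strict_antimono_on {1 - c..1} b \<and>
     b c = 0 \<and> b (1 - c) = 1 \<and>
     c < b 0 \<and> b 0 < 1/2 \<and> b ` I_L b \<subseteq> I_L b"

definition sym_bimodal :: "(real \<Rightarrow> real) \<Rightarrow> bool" where
  "sym_bimodal b \<longleftrightarrow> (\<exists>c. sym_bimodal_at b c)"

definition I_l :: "(real \<Rightarrow> real) \<Rightarrow> real set" where
  "I_l b = {(b ^^ 5) 0..(b ^^ 2) 0}"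

definition I_r :: "(real \<Rightarrow> real) \<Rightarrow> real set" where
  "I_r b = {(b ^^ 2) 1..(b ^^ 5) 1}"

definition renormalizable :: "(real \<Rightarrow> real) \<Rightarrow> bool" where
  "renormalizable b \<longleftrightarrow>
     (\<exists>c. sym_bimodal_at b c \<and>
        (b ^^ 5) 0 < (b ^^ 2) 0 \<and>
        c \<in> I_l b \<and> 1 - c \<in> I_r b \<and>
        disjoint_family_on (\<lambda>k. (b ^^ k) ` I_l b) {0, 1, 2} \<and>
        disjoint_family_on (\<lambda>k. (b ^^ k) ` I_r b) {0, 1, 2} \<and>
        (b ^^ 3) ` I_l b \<subseteq> I_l b \<and>
        (b ^^ 3) ` I_r b \<subseteq> I_r b)"

definition rev_affine :: "real \<Rightarrow> real \<Rightarrow> real \<Rightarrow> real \<Rightarrow> real \<Rightarrow> real" where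
  "rev_affine u v s t x = t - (t - s) * (x - u) / (v - u)"

lemma rev_affine_ends:
  assumes "u < v"
  shows "rev_affine u v s t u = t" "rev_affine u v s t v = s"
  using assms by (simp_all add: rev_affine_def)

lemma bij_betw_rev_affine:
  assumes "u < v" "s < t"
  shows "bij_betw (rev_affine u v s t) {u..v} {s..t}"
proof (rule bij_betw_byWitness[where f' = "rev_affine s t u v"])
  have inv: "rev_affine u' v' s' t' (rev_affine s' t' u' v' y) = y"
    if "u' < v'" "s' < t'" for u' v' s' t' y :: real
  proof -
    have "rev_affine s' t' u' v' y - u' = (v' - u') * (t' - y) / (t' - s')"
      using that by (simp add: rev_affine_def field_simps)
    then show ?thesis
      using that by (simp add: rev_affine_def)
  qed
  have img: "rev_affine u' v' s' t' ` {u'..v'} \<subseteq> {s'..t'}"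
    if "u' < v'" "s' < t'" for u' v' s' t' :: real
  proof clarify
    fix x assume "x \<in> {u'..v'}"
    then have "0 \<le> (x - u') / (v' - u')" "(x - u') / (v' - u') \<le> 1"
      using that by auto
    moreover have "rev_affine u' v' s' t' x = t' - (t' - s') * ((x - u') / (v' - u'))"
      by (simp add: rev_affine_def)
    ultimately show "rev_affine u' v' s' t' x \<in> {s'..t'}"
      using mult_nonneg_nonneg[of "t' - s'" "(x - u') / (v' - u')"]
        mult_left_le[of "(x - u') / (v' - u')" "t' - s'"] \<open>s' < t'\<close>
      unfolding atLeastAtMost_iff by linarith
  qed
  show "\<forall>a\<in>{u..v}. rev_affine s t u v (rev_affine u v s t a) = a"
    using inv assms by blast
  show "\<forall>a\<in>{s..t}. rev_affine u v s t (rev_affine s t u v a) = a"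
    using inv assms by blast
  show "rev_affine u v s t ` {u..v} \<subseteq> {s..t}"
    using img assms by blast
  show "rev_affine s t u v ` {s..t} \<subseteq> {u..v}"
    using img assms by blast
qed

definition h_l :: "(real \<Rightarrow> real) \<Rightarrow> real \<Rightarrow> real" where
  "h_l b = rev_affine 0 (b 0) ((b ^^ 5) 0) ((b ^^ 2) 0)"

definition h_r :: "(real \<Rightarrow> real) \<Rightarrow> real \<Rightarrow> real" where
  "h_r b = rev_affine (1 - b 0) 1 ((b ^^ 2) 1) ((b ^^ 5) 1)"

text \<open>
  The renormalization, as a function on \<open>I\<^sub>L \<union> I\<^sub>R\<close>; its values elsewhere have no meaning.
\<close>

definition renorm :: "(real \<Rightarrow> real) \<Rightarrow> real \<Rightarrow> real" where
  "renorm b x =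
     (if x \<in> I_L b then inv_into (I_L b) (h_l b) ((b ^^ 3) (h_l b x))
      else inv_into (I_R b) (h_r b) ((b ^^ 3) (h_r b x)))"

text \<open>
  \<open>b'\<close> is a renormalization of \<open>b\<close>, for some choice of the joining curve over the gap
  \<open>[q,1-q]\<close>. That the curve is increasing and \<open>C\<^sup>1\<close> with Lipschitz derivative is part of
  \<open>b'\<close> being a symmetric bimodal map with left critical point below \<open>b' 0 = q\<close>.
\<close>

definition is_renormalization :: "(real \<Rightarrow> real) \<Rightarrow> (real \<Rightarrow> real) \<Rightarrow> bool" where
  "is_renormalization b b' \<longleftrightarrow>
     renormalizable b \<and> sym_bimodal b' \<and> (\<forall>x \<in> I_L b \<union> I_R b. b' x = renorm b x)"

text \<open>
  For a sequence \<open>B\<close> of successive renormalizations, the composed rescalings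
  \<open>h (B 0) \<circ> \<dots> \<circ> h (B (n - 1))\<close>.
\<close>

primrec rescale_l :: "(nat \<Rightarrow> real \<Rightarrow> real) \<Rightarrow> nat \<Rightarrow> real \<Rightarrow> real" where
  "rescale_l B 0 = id"
| "rescale_l B (Suc n) = rescale_l B n \<circ> h_l (B n)"

primrec rescale_r :: "(nat \<Rightarrow> real \<Rightarrow> real) \<Rightarrow> nat \<Rightarrow> real \<Rightarrow> real" where
  "rescale_r B 0 = id"
| "rescale_r B (Suc n) = rescale_r B n \<circ> h_r (B n)"

text \<open>
  The choice of joining curves in \<open>B\<close> is immaterial: renormalizability, the intervals and the
  rescalings only depend on the restrictions to \<open>I\<^sub>L \<union> I\<^sub>R\<close>.
  The sets below are compact intervals, so their diameter is their length.
\<close>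

definition infinitely_renormalizable :: "(real \<Rightarrow> real) \<Rightarrow> bool" where
  "infinitely_renormalizable b \<longleftrightarrow>
     (\<exists>B. B 0 = b \<and>
        (\<forall>n. renormalizable (B n) \<and> is_renormalization (B n) (B (Suc n))) \<and>
        (\<lambda>n. diameter (rescale_l B n ` I_l (B n))) \<longlonglongrightarrow> 0 \<and>
        (\<lambda>n. diameter (rescale_r B n ` I_r (B n))) \<longlonglongrightarrow> 0)"

end

theory Submission
  imports Defs
begin

text \<open>
  If \<open>g\<^sup>2\<close> is affine on \<open>[0, g\<^sup>3(0)]\<close>, which contains \<open>g(I\<^sub>l)\<close>, then \<open>Rg = g\<close> on \<open>I\<^sub>L\<close> reduces to the linear
  functional equation \<open>g \<circ> h\<^sub>l = \<tau> g\<close>, where \<open>h\<^sub>l(x) = c - \<sigma>(x - c)\<close>. With \<open>\<tau> = \<sigma>\<^sup>2\<close> the derivative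
  satisfies \<open>g'(c - \<sigma> z) = -\<sigma> g'(c + z)\<close>, which is compatible with \<open>g'\<close> being Lipschitz and vanishing
  only at \<open>c\<close>. We take \<open>\<sigma> = 1/4\<close> and let \<open>g'(c + z)\<close>, \<open>z > 0\<close>, be a staircase \<open>D\<close> with
  \<open>D(z/16) = D(z)/16\<close>, whose plateaus make \<open>g\<close> affine on \<open>[0, g\<^sup>3(0)]\<close> and on its image. As a
  supremum of ramps of the same slope, \<open>D\<close> is Lipschitz.

  With \<open>q = g(0) = 8/25\<close> the orbit of \<open>c = 17/125\<close> is \<open>0, 8/25, 17/100, 1/50, 6/25, 9/100\<close>, so
  \<open>g\<close> has slope \<open>-4\<close> on \<open>[0, 1/50]\<close> and slope \<open>1\<close> on \<open>[17/100, 8/25]\<close>.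
\<close>

section \<open>The self-similar staircase\<close>

definition stair_step :: "nat \<Rightarrow> real \<Rightarrow> real" where
  "stair_step k z = max 0 (min ((1/16) ^ k) (1250/9 * z - 221/144 * (1/16) ^ k))"

definition stair :: "real \<Rightarrow> real" where
  "stair z = (SUP k. stair_step k z)"

text \<open>
  The ramp of \<open>stair\<close> climbs from \<open>1/16\<close> at \<open>23/2000 = (q - c)/16\<close> to \<open>1\<close> at \<open>73/4000\<close>. The latter
  is determined by requiring \<open>\<integral>\<^sub>0\<^bsup>q-c\<^esup> stair = g(q) = 17/100\<close>.
\<close>

definition stair_prim :: "real \<Rightarrow> real" where
  "stair_prim z = integral {-1..z} stair - integral {-1..0} stair"

lemma stair_step_bounds: "0 \<le> stair_step k z" "stair_step k z \<le> (1/16) ^ k" "stair_step k z \<le> 1"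
proof -
  show "0 \<le> stair_step k z" "stair_step k z \<le> (1/16) ^ k"
    by (auto simp: stair_step_def)
  moreover have "(1/16) ^ k \<le> (1::real)"
    by (simp add: power_le_one)
  ultimately show "stair_step k z \<le> 1"
    by linarith
qed

lemma stair_step_le_stair: "stair_step k z \<le> stair z"
  unfolding stair_def using stair_step_bounds(3)
  by (intro cSUP_upper bdd_aboveI[of _ 1]) auto

lemma stair_le: "(\<And>k. stair_step k z \<le> u) \<Longrightarrow> stair z \<le> u"
  unfolding stair_def by (rule cSUP_least) auto

lemma stair_nonneg: "0 \<le> stair z"
  using stair_step_le_stair[of 0 z] stair_step_bounds(1)[of 0 z] by linarith

lemma stair_le_one: "stair z \<le> 1"
  by (rule stair_le) (rule stair_step_bounds)

lemma stair_nonpos_arg: "stair z = 0" if "z \<le> 0"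
proof (rule antisym[OF stair_le stair_nonneg])
  fix k
  have "1250/9 * z - 221/144 * (1/16) ^ k \<le> 0"
    using that zero_le_power[of "1/16::real" k] by linarith
  then show "stair_step k z \<le> 0"
    by (simp add: stair_step_def)
qed

lemma stair_pos: "0 < stair z" if "0 < z"
proof -
  have "\<exists>k. (1/16) ^ k < z"
    using that by (intro real_arch_pow_inv) auto
  then obtain k where "(1/16) ^ k < z" ..
  then have "0 < 1250/9 * z - 221/144 * (1/16) ^ k"
    using that by linarith
  then have "0 < stair_step k z"
    by (simp add: stair_step_def less_max_iff_disj)
  then show ?thesis
    using stair_step_le_stair[of k z] by linarith
qed

lemma stair_eq_one: "stair z = 1" if "73/4000 \<le> z"
  using that stair_step_le_stair[of 0 z] stair_le_one[of z]
  by (auto simp: stair_step_def)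

lemma stair_ramp: "stair z = 1250/9 * z - 221/144" if "23/2000 \<le> z" "z \<le> 73/4000"
proof (rule antisym)
  show "1250/9 * z - 221/144 \<le> stair z"
    using that stair_step_le_stair[of 0 z] by (auto simp: stair_step_def)
  show "stair z \<le> 1250/9 * z - 221/144"
  proof (rule stair_le)
    fix k
    show "stair_step k z \<le> 1250/9 * z - 221/144"
    proof (cases k)
      case 0
      then show ?thesis
        using that by (auto simp: stair_step_def)
    next
      case (Suc j)
      \<comment> \<open>From \<open>23/2000\<close> on, the ramp of step 0 is at least
        \<open>1/16\<close>, which bounds all later steps.\<close>
      have "(1/16) ^ j \<le> (1::real)"
        by (simp add: power_le_one)
      then show ?thesis
        using stair_step_bounds(2)[of k z] that Suc by simp
    qed
  qed
qed

lemma stair_step_Suc: "stair_step (Suc k) (z / 16) = stair_step k z / 16"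
  by (auto simp: stair_step_def max_def min_def)

text \<open>Scaling shifts the step index by one, so only step 0 at \<open>z / 16\<close> needs
  care. It vanishes for \<open>z\<close> up to \<open>73/4000\<close>; beyond that
  \<open>stair z = 1\<close>, and the bound \<open>23/125\<close>, which is \<open>q - c\<close>,
  keeps \<open>z / 16\<close> at or below \<open>23/2000\<close>, where step 0 reaches
  \<open>1/16\<close>.\<close>

lemma stair_scale: "stair (z / 16) = stair z / 16" if "z \<le> 23/125"
proof (rule antisym)
  show "stair (z / 16) \<le> stair z / 16"
  proof (rule stair_le)
    fix k
    show "stair_step k (z / 16) \<le> stair z / 16"
    proof (cases k)
      case 0
      show ?thesis
      proof (cases "z \<le> 73/4000")
        case True
        then have "stair_step k (z / 16) = 0"
          by (auto simp: stair_step_def 0)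
        then show ?thesis
          using stair_nonneg[of z] by simp
      next
        case False
        then show ?thesis
          using that stair_eq_one[of z] by (simp add: stair_step_def 0 max_def)
      qed
    next
      case (Suc j)
      then show ?thesis
        using stair_step_le_stair[of j z] by (simp add: stair_step_Suc)
    qed
  qed
  have "stair z \<le> 16 * stair (z / 16)"
  proof (rule stair_le)
    fix k
    show "stair_step k z \<le> 16 * stair (z / 16)"
      using stair_step_le_stair[of "Suc k" "z / 16"] by (simp add: stair_step_Suc)
  qed
  then show "stair z / 16 \<le> stair (z / 16)"
    by simp
qed

lemma lipschitz_stair: "(1250/9)-lipschitz_on S stair"
proof (rule lipschitz_onI)
  have clamp: "max 0 (min a s) \<le> max 0 (min a t) + \<bar>s - t\<bar>" for a s t :: real
    by (auto simp: max_def min_def)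
  have *: "stair x \<le> stair y + 1250/9 * \<bar>x - y\<bar>" for x y
  proof (rule stair_le)
    fix k
    have "stair_step k x \<le> stair_step k y
        + \<bar>(1250/9 * x - 221/144 * (1/16) ^ k) - (1250/9 * y - 221/144 * (1/16) ^ k)\<bar>"
      unfolding stair_step_def by (rule clamp)
    also have "\<dots> = stair_step k y + 1250/9 * \<bar>x - y\<bar>"
      by (simp add: abs_if)
    finally have "stair_step k x \<le> stair_step k y + 1250/9 * \<bar>x - y\<bar>" .
    then show "stair_step k x \<le> stair y + 1250/9 * \<bar>x - y\<bar>"
      using stair_step_le_stair[of k y] by linarith
  qed
  show "dist (stair x) (stair y) \<le> 1250/9 * dist x y" for x y
    using *[of x y] *[of y x] unfolding dist_real_def abs_le_iff
    by (simp add: abs_minus_commute)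
qed simp

section \<open>The primitive of the staircase\<close>

text \<open>With base point -1 the derivative is two-sided also at 0 and at the negative arguments
  that \<open>fix_map\<close> produces on \<open>{0..1}\<close>.\<close>

lemma DERIV_stair_prim:
  assumes "-1 < z" "z < 1"
  shows "(stair_prim has_real_derivative stair z) (at z)"
proof -
  have "continuous_on {-1..1} stair"
    using lipschitz_stair by (rule lipschitz_on_continuous_on)
  then have "((\<lambda>x. integral {-1..x} stair) has_real_derivative stair z) (at z within {-1..1})"
    using assms by (intro integral_has_real_derivative) auto
  moreover have "at z within {-1..1} = at z"
    using assms by (intro at_within_interior) auto
  ultimately have "((\<lambda>x. integral {-1..x} stair) has_real_derivative stair z) (at z)"
    by simp
  then show ?thesis
    unfolding stair_prim_def [abs_def] by (auto intro!: derivative_eq_intros)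
qed

lemma DERIV_stair_prim_chain [derivative_intros]:
  assumes "(u has_real_derivative d) (at x)" "-1 < u x" "u x < 1" "e = stair (u x) * d"
  shows "((\<lambda>x. stair_prim (u x)) has_real_derivative e) (at x)"
  using DERIV_chain2[OF DERIV_stair_prim assms(1)] assms by simp

text \<open>Stands in for explicit integration: the values of \<open>stair_prim\<close> are found by
  matching derivatives piece by piece.\<close>

lemma DERIV_same_increment:
  fixes u v d :: "real \<Rightarrow> real"
  assumes "a \<le> b"
    and "\<And>x. a \<le> x \<Longrightarrow> x \<le> b \<Longrightarrow> (u has_real_derivative d x) (at x)"
    and "\<And>x. a \<le> x \<Longrightarrow> x \<le> b \<Longrightarrow> (v has_real_derivative d x) (at x)"
  shows "u b - u a = v b - v a"
proof (cases "a = b")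
  case False
  then have "a < b" using assms(1) by simp
  have der: "((\<lambda>x. u x - v x) has_real_derivative 0) (at x)" if "a \<le> x" "x \<le> b" for x
    using DERIV_diff[OF assms(2,3)[OF that]] by simp
  have "(\<lambda>x. u x - v x) b = (\<lambda>x. u x - v x) a"
  proof (rule DERIV_isconst_end[OF \<open>a < b\<close>])
    show "continuous_on {a..b} (\<lambda>x. u x - v x)"
      by (intro continuous_at_imp_continuous_on ballI DERIV_isCont[OF der]) auto
  qed (use der in auto)
  then show ?thesis by simp
qed simp

lemma stair_prim_0 [simp]: "stair_prim 0 = 0"
  by (simp add: stair_prim_def)

lemma stair_prim_nonpos_arg: "stair_prim z = 0" if "-1 < z" "z \<le> 0"
proof -
  have "stair_prim 0 - stair_prim z = 0 - 0"
    using that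
    by (intro DERIV_same_increment[where d = "\<lambda>_. 0" and v = "\<lambda>_. 0"])
      (auto intro!: derivative_eq_intros simp: stair_nonpos_arg)
  then show ?thesis by simp
qed

lemma stair_prim_scale: "stair_prim (z / 16) = stair_prim z / 256" if "0 \<le> z" "z \<le> 23/125"
proof -
  have "stair_prim (z / 16) - stair_prim (0 / 16) = stair_prim z / 256 - stair_prim 0 / 256"
    using that
    by (intro DERIV_same_increment[where d = "\<lambda>z. stair z / 256"])
      (auto intro!: derivative_eq_intros simp: stair_scale)
  then show ?thesis by simp
qed

text \<open>Self-similarity closes up into a linear equation for \<open>stair_prim (23/125)\<close>:
  it is the sum of its own 256th part (the value at \<open>23/2000\<close>), the ramp integral,
  computed with \<open>?r\<close>, and the length of the plateau. The solution \<open>17/100\<close>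
  gives the offset \<open>7/500\<close>.\<close>

lemma stair_prim_plateau: "stair_prim z = z - 7/500" if "73/4000 \<le> z" "z < 1"
proof -
  have plateau: "stair_prim w - stair_prim (73/4000) = w - 73/4000" if "73/4000 \<le> w" "w < 1" for w
    using that
    by (intro DERIV_same_increment[where d = "\<lambda>_. 1"])
      (auto intro!: derivative_eq_intros simp: stair_eq_one)
  let ?r = "\<lambda>z::real. 625/9 * z\<^sup>2 - 221/144 * z"
  have "stair_prim (73/4000) - stair_prim (23/2000) = ?r (73/4000) - ?r (23/2000)"
    by (intro DERIV_same_increment[where d = stair])
      (auto intro!: derivative_eq_intros simp: stair_ramp)
  moreover have "stair_prim (23/2000) = stair_prim (23/125) / 256"
    using stair_prim_scale[of "23/125"] by simp
  ultimately have "stair_prim (73/4000) = 73/4000 - 7/500"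
    using plateau[of "23/125"] by (simp add: power2_eq_square)
  then show ?thesis
    using plateau[OF that] by simp
qed

section \<open>The map: derivative, affine pieces and functional equation\<close>

text \<open>
  The first line is the unimodal map on \<open>[0, q]\<close>; the left branch is \<open>F(-z) = 16 F(z/4)\<close>, as forced by
  \<open>F(-z/4) = F(z)/16\<close> and \<open>F(z/16) = F(z)/256\<close>. The second line is its mirror image, and the last one a
  symmetric bump in the gap that makes the two halves meet at the value \<open>1/2\<close>.
\<close>

definition fix_map :: "real \<Rightarrow> real" where
  "fix_map x =
     16 * stair_prim ((17/125 - x) / 4) + stair_prim (x - 17/125)
     - 16 * stair_prim ((x - 108/125) / 4) - stair_prim (108/125 - x)
     + stair_prim (x - 42/125) - stair_prim (83/125 - x) - 2 * x + 3/2"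

definition fix_map_deriv :: "real \<Rightarrow> real" where
  "fix_map_deriv x =
     - 4 * stair ((17/125 - x) / 4) + stair (x - 17/125)
     - 4 * stair ((x - 108/125) / 4) + stair (108/125 - x)
     + stair (x - 42/125) + stair (83/125 - x) - 2"

lemma DERIV_fix_map:
  "0 \<le> x \<Longrightarrow> x \<le> 1 \<Longrightarrow> (fix_map has_real_derivative fix_map_deriv x) (at x)"
  unfolding fix_map_def [abs_def] fix_map_deriv_def
  by (auto intro!: derivative_eq_intros)

lemma fix_map_flip: "fix_map (1 - x) = 1 - fix_map x"
  by (simp add: fix_map_def algebra_simps)

lemma fix_map_deriv_flip: "fix_map_deriv (1 - x) = fix_map_deriv x"
  by (simp add: fix_map_deriv_def algebra_simps)

text \<open>Left of c the two terms on their plateaus contribute 1 + 1, which cancels the -2; only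
  the left branch remains.\<close>

lemma fix_map_deriv_neg_left: "fix_map_deriv x < 0" if "0 \<le> x" "x < 17/125"
  using that stair_pos[of "(17/125 - x) / 4"]
  by (simp add: fix_map_deriv_def stair_nonpos_arg stair_eq_one)

lemma fix_map_deriv_crit: "fix_map_deriv (17/125) = 0"
  by (simp add: fix_map_deriv_def stair_nonpos_arg stair_eq_one)

lemma fix_map_deriv_pos: "0 < fix_map_deriv x" if "17/125 < x" "x < 108/125"
proof -
  have *: "0 < fix_map_deriv x" if "17/125 < x" "x \<le> 1/2" for x
    using that stair_pos[of "x - 17/125"] stair_nonneg[of "x - 42/125"]
    by (simp add: fix_map_deriv_def stair_nonpos_arg stair_eq_one)
  show ?thesis
    using that *[of x] *[of "1 - x"] by (cases "x \<le> 1/2") (auto simp: fix_map_deriv_flip)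
qed

lemma fix_map_deriv_neg_right: "fix_map_deriv x < 0" if "108/125 < x" "x \<le> 1"
  using fix_map_deriv_neg_left[of "1 - x"] that by (simp add: fix_map_deriv_flip)

lemma fix_map_deriv_eq_0_iff:
  "fix_map_deriv x = 0 \<longleftrightarrow> x = 17/125 \<or> x = 108/125" if "0 \<le> x" "x \<le> 1"
proof -
  have "fix_map_deriv (108/125) = 0"
    using fix_map_deriv_flip[of "17/125"] fix_map_deriv_crit by simp
  then show ?thesis
    using that fix_map_deriv_crit fix_map_deriv_neg_left[of x] fix_map_deriv_pos[of x]
      fix_map_deriv_neg_right[of x]
    by (metis less_irrefl linorder_less_linear)
qed

text \<open>Two terms contribute \<open>4 * 1250/36\<close> each and four contribute
  \<open>1250/9\<close> each, in total \<open>6 * 1250/9\<close>.\<close>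

lemma lipschitz_fix_map_deriv: "(2500/3)-lipschitz_on S fix_map_deriv"
proof (rule lipschitz_onI)
  fix x y :: real
  have *: "\<bar>stair u - stair v\<bar> \<le> 1250/9 * \<bar>u - v\<bar>" for u v
    using lipschitz_onD[OF lipschitz_stair[of UNIV], of u v] by (simp add: dist_real_def)
  have quarter: "\<bar>stair ((17/125 - x) / 4) - stair ((17/125 - y) / 4)\<bar> \<le> 1250/36 * \<bar>x - y\<bar>"
    "\<bar>stair ((x - 108/125) / 4) - stair ((y - 108/125) / 4)\<bar> \<le> 1250/36 * \<bar>x - y\<bar>"
    by (rule order_trans[OF *], simp add: abs_if field_simps)+
  have "\<bar>stair (x - a) - stair (y - a)\<bar> \<le> 1250/9 * \<bar>x - y\<bar>"
    "\<bar>stair (a - x) - stair (a - y)\<bar> \<le> 1250/9 * \<bar>x - y\<bar>" for a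
    by (rule order_trans[OF *], simp add: abs_if)+
  note this(1)[of "17/125"] this(1)[of "42/125"] this(2)[of "108/125"] this(2)[of "83/125"]
  with quarter show "dist (fix_map_deriv x) (fix_map_deriv y) \<le> 2500/3 * dist x y"
    unfolding dist_real_def fix_map_deriv_def abs_le_iff by linarith
qed simp

text \<open>The mirror image and the bump are affine or zero here, and \<open>- 2 * x + 3/2\<close>
  cancels them exactly.\<close>

lemma fix_map_left:
  "fix_map x = 16 * stair_prim ((17/125 - x) / 4) + stair_prim (x - 17/125)"
  if "0 \<le> x" "x \<le> 8/25"
  using that by (simp add: fix_map_def stair_prim_nonpos_arg stair_prim_plateau)

lemma fix_map_affine_0: "fix_map x = 8/25 - 4 * x" if "0 \<le> x" "x \<le> 1/50"
proof -
  have "stair_prim ((17/125 - x) / 4) = (17/125 - x) / 4 - 7/500"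
    using that by (intro stair_prim_plateau) auto
  then show ?thesis
    using that by (simp add: fix_map_left stair_prim_nonpos_arg diff_divide_distrib)
qed

lemma fix_map_affine_q: "fix_map x = x - 3/20" if "17/100 \<le> x" "x \<le> 8/25"
  using that by (simp add: fix_map_left stair_prim_nonpos_arg stair_prim_plateau)

lemma fix_map_crit: "fix_map (17/125) = 0"
  by (simp add: fix_map_left)

text \<open>The argument is \<open>17/125 - (x - 17/125) / 4\<close>, so the two sides of c are
  exchanged. Going from left to right, the equation is built into the coefficient 16 of the left
  branch; going from right to left, it is the self-similarity of \<open>stair_prim\<close>.\<close>

lemma fix_map_scale: "fix_map (17/100 - x / 4) = fix_map x / 16" if "0 \<le> x" "x \<le> 8/25"
proof (cases "x \<le> 17/125")
  case True
  have "fix_map (17/100 - x / 4) = stair_prim (17/500 - x / 4)"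
    using that True by (simp add: fix_map_left stair_prim_nonpos_arg)
  also have "17/500 - x / 4 = (17/125 - x) / 4"
    by (simp add: diff_divide_distrib)
  also have "stair_prim \<dots> = fix_map x / 16"
    using that True by (simp add: fix_map_left stair_prim_nonpos_arg)
  finally show ?thesis .
next
  case False
  have "fix_map (17/100 - x / 4) = 16 * stair_prim ((x / 4 - 17/500) / 4)"
    using that False by (simp add: fix_map_left stair_prim_nonpos_arg)
  also have "(x / 4 - 17/500) / 4 = (x - 17/125) / 16"
    by (simp add: diff_divide_distrib)
  also have "16 * stair_prim \<dots> = fix_map x / 16"
    using that False by (simp add: fix_map_left stair_prim_nonpos_arg stair_prim_scale)
  finally show ?thesis .
qed

lemma continuous_on_fix_map: "S \<subseteq> {0..1} \<Longrightarrow> continuous_on S fix_map"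
  by (intro continuous_at_imp_continuous_on ballI DERIV_isCont[OF DERIV_fix_map]) auto

section \<open>Monotonicity and symmetric bimodality\<close>

lemma fix_map_strict_antimono_left: "strict_antimono_on {0..17/125} fix_map"
proof (rule monotone_onI)
  fix x y :: real assume *: "x \<in> {0..17/125}" "y \<in> {0..17/125}" "x < y"
  show "fix_map y < fix_map x"
  proof (rule DERIV_neg_imp_decreasing_open[OF \<open>x < y\<close>])
    show "\<exists>d. (fix_map has_real_derivative d) (at z) \<and> d < 0" if "x < z" "z < y" for z
      using * that DERIV_fix_map[of z] fix_map_deriv_neg_left[of z] by auto
  qed (use * in \<open>auto intro: continuous_on_fix_map\<close>)
qed

lemma fix_map_strict_mono: "strict_mono_on {17/125..108/125} fix_map"
proof (rule monotone_onI)
  fix x y :: real assume *: "x \<in> {17/125..108/125}" "y \<in> {17/125..108/125}" "x < y"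
  show "fix_map x < fix_map y"
  proof (rule DERIV_pos_imp_increasing_open[OF \<open>x < y\<close>])
    show "\<exists>d. (fix_map has_real_derivative d) (at z) \<and> d > 0" if "x < z" "z < y" for z
      using * that DERIV_fix_map[of z] fix_map_deriv_pos[of z] by auto
  qed (use * in \<open>auto intro: continuous_on_fix_map\<close>)
qed

lemma fix_map_strict_antimono_right: "strict_antimono_on {108/125..1} fix_map"
proof (rule monotone_onI)
  fix x y :: real assume *: "x \<in> {108/125..1}" "y \<in> {108/125..1}" "x < y"
  then have "fix_map (1 - x) < fix_map (1 - y)"
    by (intro monotone_onD[OF fix_map_strict_antimono_left]) auto
  then show "fix_map y < fix_map x"
    by (simp add: fix_map_flip)
qed

lemma fix_map_values:
  "fix_map 0 = 8/25" "fix_map (8/25) = 17/100" "fix_map (17/100) = 1/50"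
  "fix_map (1/50) = 6/25" "fix_map (6/25) = 9/100"
  by (simp_all add: fix_map_affine_0 fix_map_affine_q)

lemma fix_map_left_bounds:
  assumes "0 \<le> x" "x \<le> 8/25"
  shows "0 \<le> fix_map x" "fix_map x \<le> 8/25"
proof -
  have "0 \<le> fix_map x \<and> fix_map x \<le> 8/25"
  proof (cases x "17/125 :: real" rule: linorder_cases)
    case less
    then show ?thesis
      using assms fix_map_values(1) fix_map_crit
        monotone_onD[OF fix_map_strict_antimono_left, of 0 x]
        monotone_onD[OF fix_map_strict_antimono_left, of x "17/125"]
      by (cases "x = 0") auto
  next
    case greater
    then show ?thesis
      using assms fix_map_values(2) fix_map_crit
        mono_onD[OF strict_mono_on_imp_mono_on[OF fix_map_strict_mono], of "17/125" x]
        mono_onD[OF strict_mono_on_imp_mono_on[OF fix_map_strict_mono], of x "8/25"]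
      by simp
  next
    case equal
    show ?thesis
      unfolding equal fix_map_crit by simp
  qed
  then show "0 \<le> fix_map x" "fix_map x \<le> 8/25" by auto
qed

lemma fix_map_range: "fix_map x \<in> {0..1}" if "x \<in> {0..1}"
proof -
  consider "x \<le> 8/25" | "17/125 < x" "x < 108/125" | "1 - x \<le> 8/25"
    using that by fastforce
  then show ?thesis
  proof cases
    case 1
    then show ?thesis using that fix_map_left_bounds[of x] by auto
  next
    case 2
    then show ?thesis
      using fix_map_crit fix_map_flip[of "17/125"]
        monotone_onD[OF fix_map_strict_mono, of "17/125" x]
        monotone_onD[OF fix_map_strict_mono, of x "108/125"]
      by auto
  next
    case 3
    then show ?thesis using that fix_map_left_bounds[of "1 - x"] by (auto simp: fix_map_flip)
  qed
qed

lemma I_L_fix_map: "I_L fix_map = {0..8/25}" and I_R_fix_map: "I_R fix_map = {17/25..1}"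
  by (simp_all add: I_L_def I_R_def fix_map_values)

lemma sym_bimodal_at_fix_map: "sym_bimodal_at fix_map (17/125)"
  unfolding sym_bimodal_at_def
proof (intro conjI ballI)
  show "C1_Lip_on {0..1} fix_map"
    unfolding C1_Lip_on_def using lipschitz_fix_map_deriv
    by (intro exI[of _ fix_map_deriv] exI[of _ "2500/3"])
      (auto intro!: has_field_derivative_at_within[OF DERIV_fix_map])
  fix x :: real assume x: "x \<in> {0..1}"
  have D: "(fix_map has_real_derivative fix_map_deriv x) (at x within {0..1})"
    using x by (auto intro!: has_field_derivative_at_within[OF DERIV_fix_map])
  \<comment> \<open>Derivatives within \<open>{0..1}\<close> are unique, also at the end
    points.\<close>
  have "at x within {0..1} \<noteq> bot"
    using x by (simp add: trivial_limit_within connected_imp_perfect_aff_dim)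
  then have "(fix_map has_real_derivative 0) (at x within {0..1}) \<longleftrightarrow> fix_map_deriv x = 0"
    using D has_field_derivative_unique by metis
  then show "(fix_map has_real_derivative 0) (at x within {0..1}) \<longleftrightarrow> x = 17/125 \<or> x = 1 - 17/125"
    using fix_map_deriv_eq_0_iff[of x] x by simp
next
  show "fix_map (1 - 17/125) = 1"
    unfolding fix_map_flip by (simp add: fix_map_crit)
  show "fix_map ` I_L fix_map \<subseteq> I_L fix_map"
    unfolding I_L_fix_map using fix_map_left_bounds by auto
  show "fix_map ` {0..1} \<subseteq> {0..1}"
    using fix_map_range by blast
  show "fix_map (1 - x) = 1 - fix_map x" for x
    by (rule fix_map_flip)
  show "strict_antimono_on {0..17/125} fix_map"
    by (rule fix_map_strict_antimono_left)
  show "strict_mono_on {17/125..1 - 17/125} fix_map" "strict_antimono_on {1 - 17/125..1} fix_map"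
    using fix_map_strict_mono fix_map_strict_antimono_right by simp_all
qed (simp_all add: fix_map_crit fix_map_values)

section \<open>Critical orbit and renormalizability\<close>

text \<open>Transfers every statement about iterates on the left half to the right half.\<close>

lemma funpow_fix_map_flip: "(fix_map ^^ n) (1 - x) = 1 - (fix_map ^^ n) x"
  by (induction n) (simp_all add: fix_map_flip)

lemma funpow_fix_map_0: "(fix_map ^^ 2) 0 = 17/100" "(fix_map ^^ 5) 0 = 9/100"
  by (simp_all add: eval_nat_numeral fix_map_values)

lemma funpow_fix_map_1: "(fix_map ^^ 2) 1 = 83/100" "(fix_map ^^ 5) 1 = 91/100"
  using funpow_fix_map_flip[of _ 0] by (simp_all add: funpow_fix_map_0)

lemma I_l_fix_map: "I_l fix_map = {9/100..17/100}" and I_r_fix_map: "I_r fix_map = {83/100..91/100}"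
  by (simp_all add: I_l_def I_r_def funpow_fix_map_0 funpow_fix_map_1)

lemma h_l_fix_map: "h_l fix_map x = 17/100 - x / 4"
  by (simp add: h_l_def rev_affine_def fix_map_values funpow_fix_map_0)

lemma h_r_fix_map: "h_r fix_map x = 1 - h_l fix_map (1 - x)"
  by (simp add: h_r_def h_l_fix_map rev_affine_def fix_map_values funpow_fix_map_1 field_simps)

text \<open>The point \<open>x\<close> with \<open>h_l fix_map x = y\<close> lies in
  \<open>I_L fix_map\<close>, so the functional equation puts \<open>fix_map y\<close> into the
  affine interval \<open>{0..1/50}\<close>; the second iterate then lies in the affine interval
  ending at q.\<close>

lemma fix_map_orbit:
  assumes "9/100 \<le> y" "y \<le> 17/100"
  shows "0 \<le> fix_map y" "fix_map y \<le> 1/50" "(fix_map ^^ 2) y = 8/25 - 4 * fix_map y"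
    "(fix_map ^^ 3) y = 17/100 - 4 * fix_map y"
proof -
  define x where "x = 4 * (17/100 - y)"
  have "y = 17/100 - x / 4" and x: "0 \<le> x" "x \<le> 8/25"
    using assms by (auto simp: x_def diff_divide_distrib)
  then have "fix_map y = fix_map x / 16"
    using fix_map_scale by simp
  then show *: "0 \<le> fix_map y" "fix_map y \<le> 1/50"
    using fix_map_left_bounds[OF x] by auto
  then show "(fix_map ^^ 2) y = 8/25 - 4 * fix_map y" "(fix_map ^^ 3) y = 17/100 - 4 * fix_map y"
    by (simp_all add: eval_nat_numeral fix_map_affine_0 fix_map_affine_q)
qed

lemma renormalizable_fix_map: "renormalizable fix_map"
proof -
  let ?f = fix_map
  have l: "(?f ^^ 1) ` {9/100..17/100} \<subseteq> {0..1/50}"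
    "(?f ^^ 2) ` {9/100..17/100} \<subseteq> {6/25..8/25}"
    "(?f ^^ 3) ` {9/100..17/100} \<subseteq> {9/100..17/100}"
    using fix_map_orbit by force+
  have flip: "(?f ^^ n) ` {83/100..91/100} \<subseteq> {1 - v..1 - u}"
    if "(?f ^^ n) ` {9/100..17/100} \<subseteq> {u..v}" for n u v
  proof clarify
    fix x :: real assume "x \<in> {83/100..91/100}"
    then have "1 - x \<in> {9/100..17/100}"
      by auto
    then have "(?f ^^ n) (1 - x) \<in> {u..v}"
      using that by blast
    then show "(?f ^^ n) x \<in> {1 - v..1 - u}"
      by (simp add: funpow_fix_map_flip)
  qed
  have r: "(?f ^^ 1) ` {83/100..91/100} \<subseteq> {49/50..1}"
    "(?f ^^ 2) ` {83/100..91/100} \<subseteq> {17/25..19/25}"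
    "(?f ^^ 3) ` {83/100..91/100} \<subseteq> {83/100..91/100}"
    using flip[OF l(1)] flip[OF l(2)] flip[OF l(3)] by simp_all
  \<comment> \<open>It suffices to separate intervals that enclose the images.\<close>
  have disj: "disjoint_family_on (\<lambda>k. (?f ^^ k) ` J) {0, 1, 2}"
    if "(?f ^^ 1) ` J \<subseteq> A" "(?f ^^ 2) ` J \<subseteq> B" "J \<inter> A = {}" "J \<inter> B = {}" "A \<inter> B = {}" for J A B
  proof -
    have "J \<inter> (?f ^^ 1) ` J = {}" "J \<inter> (?f ^^ 2) ` J = {}" "(?f ^^ 1) ` J \<inter> (?f ^^ 2) ` J = {}"
      using that by blast+
    then show ?thesis
      by (simp add: disjoint_family_on_def Int_commute)
  qed
  show ?thesis
    unfolding renormalizable_def I_l_fix_map I_r_fix_map funpow_fix_map_0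
  proof (intro exI conjI)
    show "disjoint_family_on (\<lambda>k. (?f ^^ k) ` {9/100..17/100}) {0, 1, 2}"
      by (rule disj[OF l(1,2)]) auto
    show "disjoint_family_on (\<lambda>k. (?f ^^ k) ` {83/100..91/100}) {0, 1, 2}"
      by (rule disj[OF r(1,2)]) auto
  qed (use l(3) r(3) sym_bimodal_at_fix_map in auto)
qed

section \<open>The fixed point equation and shrinking of the nested intervals\<close>

text \<open>The affine second and third steps multiply by -4 and the functional equation by
  \<open>1/16\<close>; the product \<open>-1/4\<close> is the slope of
  \<open>h_l fix_map\<close>.\<close>

lemma funpow_3_h_l: "(fix_map ^^ 3) (h_l fix_map x) = h_l fix_map (fix_map x)"
  if "0 \<le> x" "x \<le> 8/25"
  using that by (simp add: fix_map_orbit h_l_fix_map fix_map_scale)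

lemma renorm_fix_map: "renorm fix_map x = fix_map x" if "x \<in> I_L fix_map \<union> I_R fix_map"
proof (cases "x \<in> I_L fix_map")
  case True
  moreover have "inj_on (h_l fix_map) (I_L fix_map)"
    by (simp add: inj_on_def h_l_fix_map)
  ultimately show ?thesis
    using fix_map_left_bounds[of x]
    by (simp add: renorm_def funpow_3_h_l I_L_fix_map)
next
  case False
  then have x: "0 \<le> 1 - x" "1 - x \<le> 8/25"
    using that by (auto simp: I_R_fix_map)
  have "(fix_map ^^ 3) (h_r fix_map x) = h_r fix_map (fix_map x)"
    using funpow_3_h_l[OF x] by (simp add: h_r_fix_map funpow_fix_map_flip fix_map_flip)
  moreover have "inj_on (h_r fix_map) (I_R fix_map)"
    by (simp add: inj_on_def h_r_fix_map h_l_fix_map)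
  ultimately show ?thesis
    using False fix_map_left_bounds[OF x]
    by (simp add: renorm_def fix_map_flip I_R_fix_map)
qed

text \<open>Both rescalings have slope \<open>-1/4\<close>, the length \<open>2/25\<close> of the
  small intervals being a quarter of \<open>8/25\<close>.\<close>

lemma dist_rescale_fix_map:
  "dist (rescale_l (\<lambda>_. fix_map) n x) (rescale_l (\<lambda>_. fix_map) n y) = (1/4) ^ n * dist x y"
  "dist (rescale_r (\<lambda>_. fix_map) n x) (rescale_r (\<lambda>_. fix_map) n y) = (1/4) ^ n * dist x y"
  by (induction n arbitrary: x y)
    (simp_all add: h_l_fix_map h_r_fix_map dist_real_def flip: diff_divide_distrib)

lemma diameter_contracted_tendsto_0:
  fixes f :: "nat \<Rightarrow> 'a :: metric_space \<Rightarrow> 'b :: real_normed_vector"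
  assumes "\<And>n x y. dist (f n x) (f n y) = k ^ n * dist x y" "bounded S" "0 \<le> k" "k < 1"
  shows "(\<lambda>n. diameter (f n ` S)) \<longlonglongrightarrow> 0"
proof (rule tendsto_sandwich)
  have le: "dist (f n x) (f n y) \<le> k ^ n * diameter S" if "x \<in> S" "y \<in> S" for n x y
    using assms that by (simp add: diameter_bounded_bound mult_left_mono)
  have "bounded (f n ` S)" for n
    unfolding bounded_two_points using le by blast
  then have "0 \<le> diameter (f n ` S)" for n
    by (rule diameter_ge_0)
  then show "\<forall>\<^sub>F n in sequentially. 0 \<le> diameter (f n ` S)" by simp
  have "diameter (f n ` S) \<le> k ^ n * diameter S" for n
    using le diameter_ge_0[OF assms(2)] assms(3)
    by (intro diameter_le) (auto simp: dist_norm)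
  then show "\<forall>\<^sub>F n in sequentially. diameter (f n ` S) \<le> k ^ n * diameter S" by simp
  show "(\<lambda>n. k ^ n * diameter S) \<longlonglongrightarrow> 0"
    using LIMSEQ_realpow_zero[OF assms(3,4)] by (rule tendsto_mult_left_zero)
qed simp

lemma infinitely_renormalizable_fix_map: "infinitely_renormalizable fix_map"
proof -
  \<comment> \<open>The joining curve is chosen to be that of \<open>fix_map\<close> itself, so the
    constant sequence is a sequence of successive renormalizations.\<close>
  have "is_renormalization fix_map fix_map"
    using renormalizable_fix_map sym_bimodal_at_fix_map renorm_fix_map
    by (auto simp: is_renormalization_def sym_bimodal_def)
  moreover have "bounded (I_l fix_map)" "bounded (I_r fix_map)"
    by (simp_all add: I_l_fix_map I_r_fix_map)
  ultimately show ?thesis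
    unfolding infinitely_renormalizable_def using renormalizable_fix_map
    by (intro exI[of _ "\<lambda>_. fix_map"] conjI allI
          diameter_contracted_tendsto_0[OF dist_rescale_fix_map(1)]
          diameter_contracted_tendsto_0[OF dist_rescale_fix_map(2)]) auto
qed

theorem theorem3p3:
  "\<exists>g :: real \<Rightarrow> real. sym_bimodal g \<and> infinitely_renormalizable g \<and>
     (\<forall>x \<in> I_L g \<union> I_R g. renorm g x = g x)"
  using sym_bimodal_at_fix_map infinitely_renormalizable_fix_map renorm_fix_map
  by (auto simp: sym_bimodal_def)

end
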